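(* Let $\alpha,\beta>-1$ and let $[a_i,b_i]\subset(-1,1)$, $i=1,\ldots,N$, be intervals. For every $i=1,\ldots,N$ and every $n\ge1$, $$\int_{a_i}^{b_i}P_n^{(\alpha,\beta)}(x)(1-x)^\alpha(1+x)^\beta\,dx=\left[-\frac{1}{2n}(1-x)^{\alpha+1}(1+x)^{\beta+1}P_{n-1}^{(\alpha+1,\beta+1)}(x)\right]_{a_i}^{b_i}.$$
   Context: $P_n^{(\alpha,\beta)}$ is the classical Jacobi polynomial of degree $n$, orthogonal with respect to $(1-x)^\alpha(1+x)^\beta$ on $(-1,1)$ and normalized by $P_n^{(\alpha,\beta)}(1)=\frac{(\alpha+1)_n}{n!}$, where $(s)_n$ is the rising factorial. $[F(x)]_a^b=F(b)-F(a)$. *)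

theory Defs
  imports "HOL-Analysis.Analysis" "HOL-Computational_Algebra.Polynomial"
begin

definition jacobi_weight :: "real \<Rightarrow> real \<Rightarrow> real \<Rightarrow> real" where
  "jacobi_weight \<alpha> \<beta> x = (1 - x) powr \<alpha> * (1 + x) powr \<beta>"

(* Orthogonality is stated with has_integral, so that integrability is part of the
   condition rather than being lost to the default value of integral. *)
definition jacobi_system :: "real \<Rightarrow> real \<Rightarrow> (nat \<Rightarrow> real poly) \<Rightarrow> bool" where
  "jacobi_system \<alpha> \<beta> P \<longleftrightarrow>
     (\<forall>n. degree (P n) = n) \<and>
     (\<forall>m n. m \<noteq> n \<longrightarrow>
        ((\<lambda>x. poly (P m) x * poly (P n) x * jacobi_weight \<alpha> \<beta> x) has_integral 0) {-1<..<1}) \<and>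
     (\<forall>n. poly (P n) 1 = pochhammer (\<alpha> + 1) n / fact n)"

(* For \<alpha>, \<beta> > -1 there is exactly one such system. *)
definition jacobi_poly :: "real \<Rightarrow> real \<Rightarrow> nat \<Rightarrow> real poly" where
  "jacobi_poly \<alpha> \<beta> = (THE P. jacobi_system \<alpha> \<beta> P)"

end

theory Submission
  imports Defs
begin

text \<open>
  Write \<open>w\<close> for the weight with parameters \<open>\<alpha>, \<beta>\<close> and \<open>w\<^sub>+\<close> for the one with parameters
  \<open>\<alpha> + 1, \<beta> + 1\<close>. The product rule gives \<open>(w\<^sub>+ q)' = w \<cdot> T q\<close>, where
  \<open>T q = (1 - x\<^sup>2) q' + ((\<beta> - \<alpha>) - (\<alpha> + \<beta> + 2) x) q\<close> is again a polynomial. By the fundamental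
  theorem of calculus, the claim is therefore the raising relation
  \<open>P\<^sub>n = - (1 / (2 n)) T P\<^sup>+\<^sub>n\<^sub>-\<^sub>1\<close> between the Jacobi polynomials for the two weights.

  As the Jacobi polynomials are characterised only by degree, orthogonality and value at \<open>1\<close>, the
  raising relation is taken as a recursive definition of a family of polynomials, and this family is
  shown to satisfy the characterisation. The degree and the value at \<open>1\<close> can be read off
  from \<open>T\<close>. Orthogonality to all polynomials \<open>p\<close> of smaller degree is integration by parts:
  \<open>\<integral> p (T q) w = - \<integral> p' q w\<^sub>+\<close>, since \<open>w\<^sub>+\<close> vanishes at both end points, and the right-hand side
  is zero by induction on the degree of the family member, because \<open>p'\<close> has smaller degree
  than \<open>p\<close> (\<open>has_integral_raising_op_by_parts\<close>, \<open>jacobi_rec_orthogonal_lower_degree\<close>).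

  For the definite description it remains to see that the system is unique. If \<open>P\<close> and \<open>Q\<close> are two
  systems, subtracting a multiple of \<open>Q\<^sub>n\<close> from \<open>P\<^sub>n\<close> leaves a polynomial \<open>D\<close> of degree less than \<open>n\<close>
  that is orthogonal to all polynomials of degree less than \<open>n\<close>, hence to itself; so \<open>D = 0\<close>, and
  the common value at \<open>1\<close>, which is nonzero, forces \<open>P\<^sub>n = Q\<^sub>n\<close>
  (\<open>jacobi_system_unique\<close>).
\<close>

section \<open>The raising operator\<close>

definition raising_op :: "real \<Rightarrow> real \<Rightarrow> real poly \<Rightarrow> real poly" where
  "raising_op \<alpha> \<beta> q = [:1, 0, -1:] * pderiv q + [:\<beta> - \<alpha>, - (\<alpha> + \<beta> + 2):] * q"

lemma has_real_derivative_jacobi_weight_times_poly: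
  assumes "-1 < x" "x < 1"
  shows "((\<lambda>x. jacobi_weight (\<alpha> + 1) (\<beta> + 1) x * poly q x) has_real_derivative
           jacobi_weight \<alpha> \<beta> x * poly (raising_op \<alpha> \<beta> q) x) (at x)"
proof -
  have *: "(1 - x) powr (\<alpha> + 1) = (1 - x) powr \<alpha> * (1 - x)"
          "(1 + x) powr (\<beta> + 1) = (1 + x) powr \<beta> * (1 + x)"
    using assms by (simp_all add: powr_add)
  have d1: "((\<lambda>x. (1 - x) powr (\<alpha> + 1)) has_real_derivative - (\<alpha> + 1) * (1 - x) powr \<alpha>) (at x)"
    using assms by (auto intro!: derivative_eq_intros simp: algebra_simps)
  have d2: "((\<lambda>x. (1 + x) powr (\<beta> + 1)) has_real_derivative (\<beta> + 1) * (1 + x) powr \<beta>) (at x)"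
    using assms by (auto intro!: derivative_eq_intros)
  show ?thesis
    unfolding jacobi_weight_def
    apply (rule DERIV_cong[OF DERIV_mult[OF DERIV_mult[OF d1 d2] poly_DERIV]])
    unfolding * by (simp add: raising_op_def algebra_simps)
qed

lemma continuous_on_jacobi_weight:
  assumes "\<alpha> > 0" "\<beta> > 0"
  shows "continuous_on {-1..1} (jacobi_weight \<alpha> \<beta>)"
  unfolding jacobi_weight_def using assms
  by (intro continuous_intros continuous_on_powr') auto

text \<open>The product rule for \<open>p \<cdot> (w\<^sub>+ q)\<close> gives integration by parts without boundary terms:
  the exponents of \<open>w\<^sub>+\<close> are positive, so \<open>w\<^sub>+\<close> is continuous up to the end points and zero there.
  Stating it as a transfer of \<open>has_integral\<close> also yields integrability against the possibly
  unbounded \<open>w\<close>.\<close>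

lemma has_integral_raising_op_by_parts:
  assumes "\<alpha> > -1" "\<beta> > -1"
    and int: "((\<lambda>x. poly (pderiv p) x * poly q x * jacobi_weight (\<alpha> + 1) (\<beta> + 1) x)
                has_integral I) {-1<..<1}"
  shows "((\<lambda>x. poly p x * poly (raising_op \<alpha> \<beta> q) x * jacobi_weight \<alpha> \<beta> x)
           has_integral - I) {-1<..<1}"
proof -
  let ?F = "\<lambda>x. poly p x * (jacobi_weight (\<alpha> + 1) (\<beta> + 1) x * poly q x)"
  let ?F' = "\<lambda>x. poly p x * poly (raising_op \<alpha> \<beta> q) x * jacobi_weight \<alpha> \<beta> x
                + poly (pderiv p) x * poly q x * jacobi_weight (\<alpha> + 1) (\<beta> + 1) x"
  have "(?F has_real_derivative ?F' x) (at x)" if "x \<in> {-1<..<1}" for x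
    using that
    by (intro DERIV_cong[OF DERIV_mult[OF poly_DERIV
          has_real_derivative_jacobi_weight_times_poly]]) (auto simp: algebra_simps)
  moreover have "continuous_on {-1..1} ?F"
    using assms by (intro continuous_intros continuous_on_jacobi_weight) auto
  ultimately have "(?F' has_integral ?F 1 - ?F (-1)) {-1..1}"
    by (intro fundamental_theorem_of_calculus_interior)
       (auto simp flip: has_real_derivative_iff_has_vector_derivative)
  then have "(?F' has_integral 0) {-1<..<1}"
    by (simp add: jacobi_weight_def flip: has_integral_Icc_iff_Ioo)
  from has_integral_diff[OF this int] show ?thesis
    by simp
qed

lemma coeff_raising_op_Suc:
  "coeff (raising_op \<alpha> \<beta> q) (Suc k) =
     (real k + 2) * coeff q (k + 2) + (\<beta> - \<alpha>) * coeff q (k + 1) - (real k + \<alpha> + \<beta> + 2) * coeff q k"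
  by (cases k) (simp_all add: raising_op_def coeff_pderiv algebra_simps)

lemma degree_raising_op:
  assumes "\<alpha> > -1" "\<beta> > -1" "q \<noteq> 0"
  shows "degree (raising_op \<alpha> \<beta> q) = Suc (degree q)"
proof (rule antisym)
  show "degree (raising_op \<alpha> \<beta> q) \<le> Suc (degree q)"
  proof (rule degree_le, intro allI impI)
    fix i assume "Suc (degree q) < i"
    then obtain k where "i = Suc k" "degree q < k"
      by (cases i) auto
    then show "coeff (raising_op \<alpha> \<beta> q) i = 0"
      by (simp add: coeff_raising_op_Suc coeff_eq_0)
  qed
  \<comment> \<open>The factor that \<open>raising_op\<close> puts on the leading coefficient, up to sign. Its positivity is
    where the lower bounds on the parameters enter.\<close>
  have "real (degree q) + \<alpha> + \<beta> + 2 > 0"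
    using assms by linarith
  then have "coeff (raising_op \<alpha> \<beta> q) (Suc (degree q)) \<noteq> 0"
    using assms by (simp add: coeff_raising_op_Suc coeff_eq_0)
  then show "Suc (degree q) \<le> degree (raising_op \<alpha> \<beta> q)"
    by (rule le_degree)
qed

lemma poly_raising_op_1: "poly (raising_op \<alpha> \<beta> q) 1 = - 2 * (\<alpha> + 1) * poly q 1"
  by (simp add: raising_op_def algebra_simps)

section \<open>Existence of the Jacobi system\<close>

text \<open>Each step lowers the index and raises both parameters, so the inductions below keep
  \<open>\<alpha>\<close> and \<open>\<beta>\<close> arbitrary.\<close>

fun jacobi_rec :: "real \<Rightarrow> real \<Rightarrow> nat \<Rightarrow> real poly" where
  "jacobi_rec \<alpha> \<beta> 0 = 1"
| "jacobi_rec \<alpha> \<beta> (Suc n) =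
     smult (- (1 / (2 * real (Suc n)))) (raising_op \<alpha> \<beta> (jacobi_rec (\<alpha> + 1) (\<beta> + 1) n))"

lemma poly_jacobi_rec_1: "poly (jacobi_rec \<alpha> \<beta> n) 1 = pochhammer (\<alpha> + 1) n / fact n"
proof (induction n arbitrary: \<alpha> \<beta>)
  case (Suc n)
  then show ?case
    unfolding jacobi_rec.simps poly_smult poly_raising_op_1 Suc.IH pochhammer_rec fact_Suc of_nat_mult
    by (simp add: divide_simps del: of_nat_Suc) (simp add: algebra_simps)
qed simp

lemma degree_jacobi_rec:
  assumes "\<alpha> > -1" "\<beta> > -1"
  shows "degree (jacobi_rec \<alpha> \<beta> n) = n"
  using assms
proof (induction n arbitrary: \<alpha> \<beta>)
  case (Suc n)
  have "poly (jacobi_rec (\<alpha> + 1) (\<beta> + 1) n) 1 \<noteq> 0"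
    using pochhammer_pos[of "\<alpha> + 1 + 1" n] Suc.prems unfolding poly_jacobi_rec_1 by simp
  then have "jacobi_rec (\<alpha> + 1) (\<beta> + 1) n \<noteq> 0"
    by auto
  with Suc show ?case
    by (simp add: degree_raising_op)
qed simp

text \<open>Integration by parts moves one derivative onto \<open>p\<close> and reduces the claim to \<open>p'\<close> and the
  preceding index for the raised weight. Taking \<open>p\<close> to be an arbitrary polynomial, not a member of
  the family, is what makes the induction work: \<open>p'\<close> need not be a Jacobi polynomial for the
  raised weight.\<close>

lemma jacobi_rec_orthogonal_lower_degree:
  assumes "\<alpha> > -1" "\<beta> > -1" "degree p < n"
  shows "((\<lambda>x. poly p x * poly (jacobi_rec \<alpha> \<beta> n) x * jacobi_weight \<alpha> \<beta> x)
           has_integral 0) {-1<..<1}"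
  using assms
proof (induction n arbitrary: \<alpha> \<beta> p)
  case (Suc n)
  let ?q = "jacobi_rec (\<alpha> + 1) (\<beta> + 1) n"
  have "((\<lambda>x. poly (pderiv p) x * poly ?q x * jacobi_weight (\<alpha> + 1) (\<beta> + 1) x)
          has_integral 0) {-1<..<1}"
  proof (cases "degree p = 0")
    \<comment> \<open>Treated separately since the induction hypothesis is void at index \<open>0\<close>.\<close>
    case True
    then have "pderiv p = 0"
      by (simp add: pderiv_eq_0_iff)
    then show ?thesis
      by simp
  next
    case False
    then have "degree (pderiv p) < n"
      using Suc.prems by (simp add: degree_pderiv)
    then show ?thesis
      using Suc.prems by (intro Suc.IH) auto
  qed
  from has_integral_raising_op_by_parts[OF Suc.prems(1,2) this]
  have "((\<lambda>x. poly p x * poly (raising_op \<alpha> \<beta> ?q) x * jacobi_weight \<alpha> \<beta> x)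
          has_integral 0) {-1<..<1}"
    by simp
  from has_integral_mult_right[OF this, of "- (1 / (2 * real (Suc n)))"] show ?case
    by (simp add: mult_ac del: of_nat_Suc)
qed simp

lemma jacobi_system_jacobi_rec:
  assumes "\<alpha> > -1" "\<beta> > -1"
  shows "jacobi_system \<alpha> \<beta> (jacobi_rec \<alpha> \<beta>)"
  unfolding jacobi_system_def
proof (intro conjI allI impI)
  fix m n :: nat
  let ?J = "jacobi_rec \<alpha> \<beta>"
  assume "m \<noteq> n"
  then consider "m < n" | "n < m"
    by linarith
  then show "((\<lambda>x. poly (?J m) x * poly (?J n) x * jacobi_weight \<alpha> \<beta> x)
               has_integral 0) {-1<..<1}"
  proof cases
    case 1
    then show ?thesis
      using assms by (intro jacobi_rec_orthogonal_lower_degree) (simp_all add: degree_jacobi_rec)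
  next
    case 2
    then have "((\<lambda>x. poly (?J n) x * poly (?J m) x * jacobi_weight \<alpha> \<beta> x)
                 has_integral 0) {-1<..<1}"
      using assms by (intro jacobi_rec_orthogonal_lower_degree) (simp_all add: degree_jacobi_rec)
    then show ?thesis
      by (simp add: mult_ac)
  qed
qed (use assms in \<open>simp_all add: degree_jacobi_rec poly_jacobi_rec_1\<close>)

section \<open>Uniqueness of the Jacobi system\<close>

text \<open>Since the \<open>k\<close>-th member of a system has degree \<open>k\<close>, its first \<open>n\<close> members span the polynomials of
  degree less than \<open>n\<close>; the induction on the degree removes leading terms one at a time.\<close>

lemma jacobi_system_orthogonal_lower_degree:
  assumes "\<alpha> > -1" and P: "jacobi_system \<alpha> \<beta> P" and "degree p < n"
  shows "((\<lambda>x. poly p x * poly (P n) x * jacobi_weight \<alpha> \<beta> x) has_integral 0) {-1<..<1}"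
  using assms(3)
proof (induction "degree p" arbitrary: p rule: less_induct)
  case less
  define m where "m = degree p"
  define c where "c = lead_coeff p / lead_coeff (P m)"
  define r where "r = p - smult c (P m)"
  have deg: "degree (P m) = m"
    using P by (simp add: jacobi_system_def)
  have Pm: "((\<lambda>x. poly (P m) x * poly (P n) x * jacobi_weight \<alpha> \<beta> x) has_integral 0) {-1<..<1}"
    using P less.prems by (auto simp: jacobi_system_def m_def)
  have "poly (P m) 1 \<noteq> 0"
    using P pochhammer_pos[of "\<alpha> + 1" m] assms(1) by (simp add: jacobi_system_def)
  then have "P m \<noteq> 0"
    by auto
  then have "coeff (P m) m \<noteq> 0"
    using deg by (metis leading_coeff_0_iff)
  then have "coeff r m = 0"
    by (simp add: r_def c_def deg) (simp add: m_def)
  moreover have "degree r \<le> m"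
    unfolding r_def using deg by (intro degree_diff_le) (auto simp: m_def)
  ultimately have "r = 0 \<or> degree r < m"
    by (intro eq_zero_or_degree_less)
  then have r: "((\<lambda>x. poly r x * poly (P n) x * jacobi_weight \<alpha> \<beta> x) has_integral 0) {-1<..<1}"
    using less by (auto simp: m_def)
  from has_integral_add[OF r has_integral_mult_right[OF Pm, of c]] show ?case
    by (simp add: r_def algebra_simps)
qed

text \<open>The weight may be unbounded at the end points of the interval. The vanishing integral of the
  nonnegative function \<open>p\<^sup>2 w\<close> is therefore restricted to a compact subinterval, where the integrand
  is continuous and hence zero; \<open>p\<close> then has infinitely many roots.\<close>

lemma poly_eq_0_if_jacobi_norm_eq_0:
  assumes "((\<lambda>x. poly p x * poly p x * jacobi_weight \<alpha> \<beta> x) has_integral 0) {-1<..<1}"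
  shows "p = 0"
proof -
  let ?f = "\<lambda>x. poly p x * poly p x * jacobi_weight \<alpha> \<beta> x"
  have nonneg: "?f x \<ge> 0" for x
    by (simp add: jacobi_weight_def)
  have cont: "continuous_on {-1/2..1/2} ?f"
    unfolding jacobi_weight_def by (intro continuous_intros) auto
  then have I: "?f integrable_on {-1/2..1/2}"
    by (rule integrable_continuous_real)
  have "integral {-1/2..1/2} ?f \<le> integral {-1<..<1} ?f"
    using assms I nonneg by (intro integral_subset_le) (auto simp: has_integral_integrable)
  also have "\<dots> = 0"
    using assms by (rule integral_unique)
  finally have "integral {-1/2..1/2} ?f = 0"
    using integral_nonneg[OF I] nonneg by (meson antisym)
  with I have 0: "(?f has_integral 0) (cbox (-1/2) (1/2))"
    using integrable_integral by fastforce
  have "?f x = 0" if "x \<in> {-1/2..1/2}" for x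
    using cont nonneg that by (intro has_integral_0_cbox_imp_0[OF _ _ 0]) auto
  then have "{-1/2..1/2} \<subseteq> {x. poly p x = 0}"
    by (force simp: jacobi_weight_def)
  moreover have "infinite {-1/2..1/2 :: real}"
    by simp
  ultimately show "p = 0"
    using poly_roots_finite finite_subset by blast
qed

lemma jacobi_system_unique:
  assumes "\<alpha> > -1" and P: "jacobi_system \<alpha> \<beta> P" and Q: "jacobi_system \<alpha> \<beta> Q"
  shows "P = Q"
proof
  fix n
  have deg: "degree (P n) = n" "degree (Q n) = n"
    and at_1: "poly (P n) 1 = poly (Q n) 1" "poly (Q n) 1 \<noteq> 0"
    using P Q pochhammer_pos[of "\<alpha> + 1" n] assms(1) by (auto simp: jacobi_system_def)
  define c where "c = lead_coeff (P n) / lead_coeff (Q n)"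
  define D where "D = P n - smult c (Q n)"
  have "Q n \<noteq> 0"
    using at_1 by auto
  then have "coeff D n = 0"
    using deg by (simp add: D_def c_def) (metis leading_coeff_0_iff)
  moreover have "degree D \<le> n"
    unfolding D_def using deg by (intro degree_diff_le) auto
  ultimately have "D = 0 \<or> degree D < n"
    by (intro eq_zero_or_degree_less)
  then have "D = 0"
  proof
    assume "degree D < n"
    \<comment> \<open>\<open>D\<close> is a combination of \<open>P n\<close> and \<open>Q n\<close>, both of which are orthogonal to it.\<close>
    note orth = jacobi_system_orthogonal_lower_degree[OF assms(1) _ this]
    from has_integral_diff[OF orth[OF P] has_integral_mult_right[OF orth[OF Q], of c]]
    have "((\<lambda>x. poly D x * poly D x * jacobi_weight \<alpha> \<beta> x) has_integral 0) {-1<..<1}"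
      by (simp add: D_def algebra_simps)
    then show "D = 0"
      by (rule poly_eq_0_if_jacobi_norm_eq_0)
  qed
  then have "P n = smult c (Q n)"
    by (simp add: D_def)
  then show "P n = Q n"
    using at_1 by simp
qed

lemma jacobi_poly_eq_jacobi_rec:
  assumes "\<alpha> > -1" "\<beta> > -1"
  shows "jacobi_poly \<alpha> \<beta> = jacobi_rec \<alpha> \<beta>"
  unfolding jacobi_poly_def
proof (rule the_equality[where P = "jacobi_system \<alpha> \<beta>"])
  show system: "jacobi_system \<alpha> \<beta> (jacobi_rec \<alpha> \<beta>)"
    using assms by (rule jacobi_system_jacobi_rec)
  show "P = jacobi_rec \<alpha> \<beta>" if "jacobi_system \<alpha> \<beta> P" for P
    using assms(1) that system by (rule jacobi_system_unique)
qed

section \<open>The integral over a subinterval\<close>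

theorem lemma4:
  fixes \<alpha> \<beta> :: real and a b :: "nat \<Rightarrow> real" and N :: nat
  assumes "\<alpha> > -1" and "\<beta> > -1"
    and "\<And>i. i \<in> {1..N} \<Longrightarrow> a i \<le> b i \<and> {a i..b i} \<subseteq> {-1<..<1}"
  shows "\<forall>i\<in>{1..N}. \<forall>n\<ge>1.
    ((\<lambda>x. poly (jacobi_poly \<alpha> \<beta> n) x * (1 - x) powr \<alpha> * (1 + x) powr \<beta>) has_integral
      (let F = (\<lambda>x. - (1 / (2 * real n)) * (1 - x) powr (\<alpha> + 1) * (1 + x) powr (\<beta> + 1) *
                     poly (jacobi_poly (\<alpha> + 1) (\<beta> + 1) (n - 1)) x)
       in F (b i) - F (a i))) {a i..b i}"
proof (intro ballI allI impI)
  fix i n :: nat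
  assume i: "i \<in> {1..N}" and "n \<ge> 1"
  define m where "m = n - 1"
  have n: "n = Suc m"
    using \<open>n \<ge> 1\<close> by (simp add: m_def)
  define c where "c = - (1 / (2 * real n))"
  define q where "q = jacobi_poly (\<alpha> + 1) (\<beta> + 1) m"
  let ?F = "\<lambda>x. c * (jacobi_weight (\<alpha> + 1) (\<beta> + 1) x * poly q x)"
  let ?f = "\<lambda>x. c * (jacobi_weight \<alpha> \<beta> x * poly (raising_op \<alpha> \<beta> q) x)"
  have raise: "jacobi_poly \<alpha> \<beta> n = smult c (raising_op \<alpha> \<beta> q)"
    using assms(1,2) by (simp add: jacobi_poly_eq_jacobi_rec n c_def q_def)
  have "(?F has_real_derivative ?f x) (at x)" if "x \<in> {a i..b i}" for x
    using assms(3)[OF i] that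
    by (intro DERIV_cmult has_real_derivative_jacobi_weight_times_poly) auto
  then have "(?f has_integral ?F (b i) - ?F (a i)) {a i..b i}"
    using assms(3)[OF i]
    by (intro fundamental_theorem_of_calculus)
       (auto simp flip: has_real_derivative_iff_has_vector_derivative
             intro: has_field_derivative_at_within)
  then show "((\<lambda>x. poly (jacobi_poly \<alpha> \<beta> n) x * (1 - x) powr \<alpha> * (1 + x) powr \<beta>) has_integral
      (let F = (\<lambda>x. - (1 / (2 * real n)) * (1 - x) powr (\<alpha> + 1) * (1 + x) powr (\<beta> + 1) *
                     poly (jacobi_poly (\<alpha> + 1) (\<beta> + 1) (n - 1)) x)
       in F (b i) - F (a i))) {a i..b i}"
    unfolding raise jacobi_weight_def Let_def m_def[symmetric] q_def[symmetric] c_def[symmetric]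
    by (simp add: mult_ac)
qed

end
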